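(* Let $\mathbb F$ be an algebraically closed field and $V$ a vector space over $\mathbb F$ of dimension $d+1$ with $d\ge3$. Let $\Phi=(A;\{E_i\}_{i=0}^d;A^*;\{E^*_i\}_{i=0}^d)$ be a Leonard system on $V$, with dual eigenvalue sequence $\{\theta^*_i\}_{i=0}^d$, and let $a_i=\mathrm{tr}(E^*_iA)$ for $0\le i\le d$. Then the following are equivalent: (i) ${\mathcal Z}(\Phi)\ne0$; (ii) there exist scalars $f_0,f_1,f_2,f_3\in\mathbb F$ (not all zero) such that $f_0+f_1\theta^*_i+f_2a_i+f_3a_i\theta^*_i=0$ for $0\le i\le d$.
   Context: A tridiagonal matrix is irreducible if all entries on its subdiagonal and superdiagonal are nonzero. A Leonard pair on $V$ is an ordered pair $A,A^*\in \mathrm{End}(V)$ such that (i) there is a basis of $V$ with respect to which $A$ is irreducible tridiagonal and $A^*$ is diagonal; (ii) there is a basis of $V$ with respect to which $A^*$ is irreducible tridiagonal and $A$ is diagonal. Then $A,A^*$ are multiplicity-free (diagonalizable with one-dimensional eigenspaces). The primitive idempotent of $A$ for an eigenvalue $\theta$ is the projection onto the $\theta$-eigenspace along the sum of the other eigenspaces. An ordering of the eigenvalues of $A$ (and the corresponding ordering $\{E_i\}_{i=0}^d$ of primitive idempotents) is standard if corresponding eigenvectors $v_0,\dots,v_d$, in this order, form a basis as in (ii). Standard orderings for $A^*$ are defined similarly using (i). A Leonard system on $V$ is a sequence $\Phi=(A;\{E_i\}_{i=0}^d;A^*;\{E^*_i\}_{i=0}^d)$ where $A,A^*$ is a Leonard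 pair on $V$ and $\{E_i\}$, $\{E^*_i\}$ are standard orderings of the primitive idempotents of $A$, $A^*$. The dual eigenvalue sequence $\{\theta^*_i\}$ is given by $A^*E^*_i=\theta^*_iE^*_i$. Zero diagonal space: ${\mathcal Z}(\Phi)$ is the set of $X\in\mathrm{Span}\{I,A^*,A,AA^*\}$ such that $E^*_iXE^*_i=0$ for $0\le i\le d$. Known fact: $I,A^*,A,AA^*,A^*A$ are linearly independent. *)

theory Defs
  imports
    "HOL-Computational_Algebra.Polynomial"
    "HOL-Library.Function_Algebras"
begin

text \<open>
  The vector space is the whole type \<open>'b\<close> with scalar multiplication \<open>scale\<close> over the field \<open>'a\<close>;
  endomorphisms are functions satisfying \<^term>\<open>Vector_Spaces.linear scale scale\<close>, with
  composition as product. The sum and the zero of endomorphisms are the pointwise ones of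
  \<^theory>\<open>HOL-Library.Function_Algebras\<close>; the product \<open>*\<close> and the unit \<open>1\<close> of that theory are
  also pointwise and are not used. Families \<open>E\<^sub>0, \<dots>, E\<^sub>d\<close> are functions on \<open>nat\<close> whose values
  beyond \<open>d\<close> are irrelevant.

  The prefix \<open>local\<close> is needed because the library interprets \<^locale>\<open>vector_space\<close> for real
  vector spaces with an optional qualifier, and the real instances shadow the new names.
\<close>

context vector_space
begin

definition ordered_basis :: "nat \<Rightarrow> (nat \<Rightarrow> 'b) \<Rightarrow> bool" where
  "ordered_basis d v \<longleftrightarrow> inj_on v {..d} \<and> independent (v ` {..d}) \<and> span (v ` {..d}) = UNIV"

text \<open>Column \<open>j\<close> of the matrix holds the coordinates of the image of the \<open>j\<close>-th basis vector.\<close>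

definition matrix_entry :: "nat \<Rightarrow> (nat \<Rightarrow> 'b) \<Rightarrow> ('b \<Rightarrow> 'b) \<Rightarrow> nat \<Rightarrow> nat \<Rightarrow> 'a" where
  "matrix_entry d v X i j = representation (v ` {..d}) (X (v j)) (v i)"

definition diagonal_wrt :: "nat \<Rightarrow> (nat \<Rightarrow> 'b) \<Rightarrow> ('b \<Rightarrow> 'b) \<Rightarrow> bool" where
  "diagonal_wrt d v X \<longleftrightarrow> (\<forall>i\<le>d. \<forall>j\<le>d. i \<noteq> j \<longrightarrow> local.matrix_entry d v X i j = 0)"

definition irreducible_tridiagonal_wrt :: "nat \<Rightarrow> (nat \<Rightarrow> 'b) \<Rightarrow> ('b \<Rightarrow> 'b) \<Rightarrow> bool" where
  "irreducible_tridiagonal_wrt d v X \<longleftrightarrow>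
     (\<forall>i\<le>d. \<forall>j\<le>d. (i + 1 < j \<or> j + 1 < i) \<longrightarrow> local.matrix_entry d v X i j = 0) \<and>
     (\<forall>i<d. local.matrix_entry d v X i (i + 1) \<noteq> 0 \<and> local.matrix_entry d v X (i + 1) i \<noteq> 0)"

definition leonard_pair :: "nat \<Rightarrow> ('b \<Rightarrow> 'b) \<Rightarrow> ('b \<Rightarrow> 'b) \<Rightarrow> bool" where
  "leonard_pair d A Astar \<longleftrightarrow>
     Vector_Spaces.linear scale scale A \<and> Vector_Spaces.linear scale scale Astar \<and>
     (\<exists>v. local.ordered_basis d v \<and> local.irreducible_tridiagonal_wrt d v A \<and> local.diagonal_wrt d v Astar) \<and>
     (\<exists>v. local.ordered_basis d v \<and> local.irreducible_tridiagonal_wrt d v Astar \<and> local.diagonal_wrt d v A)"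

definition eigenspace :: "('b \<Rightarrow> 'b) \<Rightarrow> 'a \<Rightarrow> 'b set" where
  "eigenspace X t = {v. X v = scale t v}"

definition eigenvalues :: "('b \<Rightarrow> 'b) \<Rightarrow> 'a set" where
  "eigenvalues X = {t. \<exists>v. v \<noteq> 0 \<and> X v = scale t v}"

definition projection_onto_along :: "('b \<Rightarrow> 'b) \<Rightarrow> 'b set \<Rightarrow> 'b set \<Rightarrow> bool" where
  "projection_onto_along P U W \<longleftrightarrow>
     Vector_Spaces.linear scale scale P \<and> P \<circ> P = P \<and> range P = U \<and> {v. P v = 0} = W"

text \<open>The sum of a family of subspaces is the span of their union.\<close>

definition primitive_idempotent :: "('b \<Rightarrow> 'b) \<Rightarrow> 'a \<Rightarrow> ('b \<Rightarrow> 'b) \<Rightarrow> bool" where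
  "primitive_idempotent X t P \<longleftrightarrow>
     t \<in> local.eigenvalues X \<and>
     local.projection_onto_along P (local.eigenspace X t) (span (\<Union>s \<in> local.eigenvalues X - {t}. local.eigenspace X s))"

definition standard_eigenvalue_ordering ::
  "nat \<Rightarrow> ('b \<Rightarrow> 'b) \<Rightarrow> ('b \<Rightarrow> 'b) \<Rightarrow> (nat \<Rightarrow> 'a) \<Rightarrow> bool" where
  "standard_eigenvalue_ordering d X Y t \<longleftrightarrow>
     bij_betw t {..d} (local.eigenvalues X) \<and>
     (\<exists>v. (\<forall>i\<le>d. v i \<noteq> 0 \<and> X (v i) = scale (t i) (v i)) \<and>
          local.ordered_basis d v \<and> local.irreducible_tridiagonal_wrt d v Y \<and> local.diagonal_wrt d v X)"

definition standard_idempotent_ordering ::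
  "nat \<Rightarrow> ('b \<Rightarrow> 'b) \<Rightarrow> ('b \<Rightarrow> 'b) \<Rightarrow> (nat \<Rightarrow> 'b \<Rightarrow> 'b) \<Rightarrow> bool" where
  "standard_idempotent_ordering d X Y E \<longleftrightarrow>
     (\<exists>t. local.standard_eigenvalue_ordering d X Y t \<and> (\<forall>i\<le>d. local.primitive_idempotent X (t i) (E i)))"

definition leonard_system ::
  "nat \<Rightarrow> ('b \<Rightarrow> 'b) \<Rightarrow> (nat \<Rightarrow> 'b \<Rightarrow> 'b) \<Rightarrow> ('b \<Rightarrow> 'b) \<Rightarrow> (nat \<Rightarrow> 'b \<Rightarrow> 'b) \<Rightarrow> bool" where
  "leonard_system d A E Astar Estar \<longleftrightarrow>
     local.leonard_pair d A Astar \<and>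
     local.standard_idempotent_ordering d A Astar E \<and>
     local.standard_idempotent_ordering d Astar A Estar"

definition dual_eigenvalue_sequence ::
  "nat \<Rightarrow> ('b \<Rightarrow> 'b) \<Rightarrow> (nat \<Rightarrow> 'b \<Rightarrow> 'b) \<Rightarrow> (nat \<Rightarrow> 'a) \<Rightarrow> bool" where
  "dual_eigenvalue_sequence d Astar Estar t \<longleftrightarrow>
     (\<forall>i\<le>d. Astar \<circ> Estar i = (\<lambda>v. scale (t i) (Estar i v)))"

definition zero_diagonal_space ::
  "nat \<Rightarrow> ('b \<Rightarrow> 'b) \<Rightarrow> ('b \<Rightarrow> 'b) \<Rightarrow> (nat \<Rightarrow> 'b \<Rightarrow> 'b) \<Rightarrow> ('b \<Rightarrow> 'b) set" where
  "zero_diagonal_space d A Astar Estar =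
     {X \<in> module.span (\<lambda>c F v. scale c (F v)) {id, Astar, A, A \<circ> Astar}.
        \<forall>i\<le>d. Estar i \<circ> X \<circ> Estar i = 0}"

text \<open>
  The trace of the matrix with respect to a basis. The basis is arbitrary: by \<open>trace_eq\<close> below,
  every basis of a finite-dimensional space gives the same value.
\<close>

definition trace :: "('b \<Rightarrow> 'b) \<Rightarrow> 'a" where
  "trace X = (let B = SOME B. independent B \<and> span B = UNIV in \<Sum>b\<in>B. representation B (X b) b)"

lemma vector_space_pointwise: "vector_space (\<lambda>c (F :: 'b \<Rightarrow> 'b) v. scale c (F v))"
  by unfold_locales (auto simp: fun_eq_iff scale_right_distrib scale_left_distrib)

lemma trace_basis_independent:
  assumes X: "Vector_Spaces.linear scale scale X"
    and B: "finite B" "independent B" "span B = UNIV"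
    and C: "finite C" "independent C" "span C = UNIV"
  shows "(\<Sum>b\<in>B. representation B (X b) b) = (\<Sum>c\<in>C. representation C (X c) c)"
proof -
  interpret X: Vector_Spaces.linear scale scale X by (rule X)
  have exp: "(\<Sum>b\<in>D. scale (representation D x b) b) = x"
    if "finite D" "independent D" "span D = UNIV" for D x
    using that by (intro sum_representation_eq) auto
  have rep: "representation D (\<Sum>i\<in>I. scale (f i) (g i)) y = (\<Sum>i\<in>I. f i * representation D (g i) y)"
    if "independent D" "span D = UNIV" for D I y and f :: "'b \<Rightarrow> 'a" and g :: "'b \<Rightarrow> 'b"
    using that by (subst representation_sum) (auto simp: representation_scale)
  have "(\<Sum>b\<in>B. representation B (X b) b)
      = (\<Sum>b\<in>B. \<Sum>c\<in>C. representation C (X b) c * representation B c b)"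
  proof (intro sum.cong refl)
    fix b assume "b \<in> B"
    have "representation B (X b) b
        = representation B (\<Sum>c\<in>C. scale (representation C (X b) c) c) b"
      by (simp only: exp[OF C])
    also have "\<dots> = (\<Sum>c\<in>C. representation C (X b) c * representation B c b)"
      by (rule rep[OF B(2,3)])
    finally show "representation B (X b) b = \<dots>" .
  qed
  also have "\<dots> = (\<Sum>c\<in>C. \<Sum>b\<in>B. representation B c b * representation C (X b) c)"
    by (subst sum.swap) (simp add: mult.commute)
  also have "\<dots> = (\<Sum>c\<in>C. representation C (X c) c)"
  proof (intro sum.cong refl)
    fix c assume "c \<in> C"
    have "X c = X (\<Sum>b\<in>B. scale (representation B c b) b)"
      by (simp only: exp[OF B])
    also have "\<dots> = (\<Sum>b\<in>B. scale (representation B c b) (X b))"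
      by (simp add: X.sum X.scale)
    finally show "(\<Sum>b\<in>B. representation B c b * representation C (X b) c) = representation C (X c) c"
      by (simp add: rep[OF C(2,3)])
  qed
  finally show ?thesis .
qed

lemma trace_eq:
  assumes X: "Vector_Spaces.linear scale scale X"
    and B: "finite B" "independent B" "span B = UNIV"
  shows "local.trace X = (\<Sum>b\<in>B. representation B (X b) b)"
proof -
  define C where "C = (SOME B. independent B \<and> span B = UNIV)"
  have C: "independent C \<and> span C = UNIV"
    unfolding C_def by (rule someI[of _ B]) (use B in auto)
  have "finite C"
    using independent_span_bound[OF B(1), of C] B C by auto
  with C show ?thesis
    using local.trace_basis_independent[OF X B, of C] by (simp add: local.trace_def flip: C_def)
qed

end

end

theory Submission
  imports Defs
begin

text \<open>
  Work in a basis \<open>v\<^sub>0, \<dots>, v\<^sub>d\<close> of eigenvectors of \<open>A\<^sup>*\<close> in which \<open>A\<close> is irreducible tridiagonal.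
  There \<open>E\<^sup>*\<^sub>i\<close> projects onto the \<open>i\<close>-th coordinate, so \<open>a\<^sub>i\<close> is the \<open>i\<close>-th diagonal entry of \<open>A\<close>,
  and for \<open>X = f\<^sub>0 I + f\<^sub>1 A\<^sup>* + f\<^sub>2 A + f\<^sub>3 A A\<^sup>*\<close> the condition \<open>E\<^sup>*\<^sub>i X E\<^sup>*\<^sub>i = 0\<close> says that the \<open>i\<close>-th
  diagonal entry \<open>f\<^sub>0 + f\<^sub>1 \<theta>\<^sup>*\<^sub>i + f\<^sub>2 a\<^sub>i + f\<^sub>3 a\<^sub>i \<theta>\<^sup>*\<^sub>i\<close> of \<open>X\<close> vanishes. Conversely \<open>X = 0\<close> forces all
  \<open>f\<^sub>k\<close> to vanish: the subdiagonal entries of \<open>X\<close> give \<open>f\<^sub>2 + f\<^sub>3 \<theta>\<^sup>*\<^sub>i = 0\<close> for \<open>i < d\<close>, and the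
  \<open>\<theta>\<^sup>*\<^sub>i\<close> are distinct.
\<close>

context vector_space
begin

lemma representation_ordered_basis:
  assumes "local.ordered_basis d v" and "i \<le> d" "j \<le> d"
  shows "representation (v ` {..d}) (v j) (v i) = (if i = j then 1 else 0)"
  using assms by (auto simp: local.ordered_basis_def representation_basis inj_on_eq_iff)

lemma linear_representation:
  assumes "local.ordered_basis d v"
  shows "Vector_Spaces.linear scale (*) (\<lambda>x. representation (v ` {..d}) x b)"
proof -
  interpret f: vector_space "(*) :: 'a \<Rightarrow> 'a \<Rightarrow> 'a"
    by unfold_locales (auto simp: algebra_simps)
  show ?thesis
    using assms unfolding local.ordered_basis_def
    by unfold_locales (auto simp: representation_add representation_scale)
qed

text \<open>\<open>P\<close> is idempotent with \<open>v i\<close> in its range, so it fixes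
  \<open>v i\<close>. Every other \<open>v j\<close> belongs to a different eigenvalue and hence
  lies in the kernel. This turns the abstract projection into a coordinate projection of the
  eigenbasis.\<close>

lemma primitive_idempotent_eigenbasis:
  assumes P: "local.primitive_idempotent X (t i) P"
    and t: "inj_on t {..d}"
    and v: "local.ordered_basis d v" "\<And>j. j \<le> d \<Longrightarrow> v j \<noteq> 0 \<and> X (v j) = scale (t j) (v j)"
    and i: "i \<le> d"
  shows "P x = scale (representation (v ` {..d}) x (v i)) (v i)"
proof -
  let ?B = "v ` {..d}"
  have proj: "local.projection_onto_along P (local.eigenspace X (t i))
      (span (\<Union>s \<in> local.eigenvalues X - {t i}. local.eigenspace X s))"
    using P by (simp add: local.primitive_idempotent_def)
  then interpret P: Vector_Spaces.linear scale scale P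
    by (simp add: local.projection_onto_along_def)
  have self: "P (v i) = v i"
  proof -
    have "v i \<in> range P"
      using proj v(2)[OF i] by (simp add: local.projection_onto_along_def local.eigenspace_def)
    then obtain w where "v i = P w" by auto
    moreover have "P (P w) = P w"
      using proj by (auto simp: local.projection_onto_along_def fun_eq_iff)
    ultimately show ?thesis by simp
  qed
  have other: "P (v j) = 0" if "j \<le> d" "j \<noteq> i" for j
  proof -
    have "t j \<noteq> t i"
      using t that i by (auto simp: inj_on_eq_iff)
    moreover have "t j \<in> local.eigenvalues X"
      using v(2)[OF that(1)] by (auto simp: local.eigenvalues_def)
    moreover have "v j \<in> local.eigenspace X (t j)"
      using v(2)[OF that(1)] by (simp add: local.eigenspace_def)
    ultimately have "v j \<in> span (\<Union>s \<in> local.eigenvalues X - {t i}. local.eigenspace X s)"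
      by (intro span_base) blast
    then show ?thesis
      using proj by (auto simp: local.projection_onto_along_def)
  qed
  have ob: "inj_on v {..d}" "independent ?B" "span ?B = UNIV"
    using v(1) by (auto simp: local.ordered_basis_def)
  have "x = (\<Sum>b\<in>?B. scale (representation ?B x b) b)"
    using ob by (intro sum_representation_eq[symmetric]) auto
  also have "\<dots> = (\<Sum>j\<le>d. scale (representation ?B x (v j)) (v j))"
    using ob(1) by (simp add: sum.reindex)
  finally have "P x = P (\<Sum>j\<le>d. scale (representation ?B x (v j)) (v j))"
    by (rule arg_cong)
  also have "\<dots> = (\<Sum>j\<le>d. scale (representation ?B x (v j)) (P (v j)))"
    by (simp add: P.sum P.scale)
  also have "\<dots> = (\<Sum>j\<le>d. if j = i then scale (representation ?B x (v i)) (v i) else 0)"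
    by (intro sum.cong) (auto simp: self other)
  finally show ?thesis using i by simp
qed

text \<open>Since \<open>P\<close> maps into the line through \<open>v i\<close>, only the
  \<open>i\<close>-th diagonal entry of \<open>P \<circ> X\<close> in the basis \<open>v\<close> can
  be nonzero.\<close>

lemma trace_coordinate_projection_comp:
  assumes v: "local.ordered_basis d v" and i: "i \<le> d"
    and P: "\<And>x. P x = scale (representation (v ` {..d}) x (v i)) (v i)"
    and X: "Vector_Spaces.linear scale scale X"
  shows "local.trace (P \<circ> X) = local.matrix_entry d v X i i"
proof -
  let ?B = "v ` {..d}"
  interpret X: Vector_Spaces.linear scale scale X by (rule X)
  interpret r: Vector_Spaces.linear scale "(*)" "\<lambda>x. representation ?B x (v i)"
    by (rule linear_representation[OF v])
  have ob: "inj_on v {..d}" "independent ?B" "span ?B = UNIV"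
    using v by (auto simp: local.ordered_basis_def)
  have "Vector_Spaces.linear scale scale (P \<circ> X)"
    by unfold_locales (auto simp: P X.add X.scale r.add r.scale scale_left_distrib)
  then have "local.trace (P \<circ> X) = (\<Sum>b\<in>?B. representation ?B ((P \<circ> X) b) b)"
    using ob by (intro trace_eq) auto
  also have "\<dots> = (\<Sum>j\<le>d. representation ?B (P (X (v j))) (v j))"
    using ob(1) by (simp add: sum.reindex)
  also have "\<dots> = (\<Sum>j\<le>d. if j = i then local.matrix_entry d v X i i else 0)"
    by (intro sum.cong)
      (use ob i v in \<open>auto simp: P representation_scale representation_ordered_basis
         local.matrix_entry_def\<close>)
  finally show ?thesis using i by simp
qed

text \<open>Gives access to the coefficients of an element of the span; the quadruple need not be
  unique.\<close>

lemma span_pointwise_four: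
  fixes X :: "'b \<Rightarrow> 'b"
  shows "X \<in> module.span (\<lambda>c F v. scale c (F v)) {F0, F1, F2, F3} \<longleftrightarrow>
   (\<exists>c0 c1 c2 c3. X = (\<lambda>x. scale c0 (F0 x) + scale c1 (F1 x) + scale c2 (F2 x) + scale c3 (F3 x)))"
proof -
  interpret W: vector_space "\<lambda>c (F :: 'b \<Rightarrow> 'b) v. scale c (F v)"
    by (rule vector_space_pointwise)
  \<comment> \<open>\<open>W.span_breakdown_eq\<close> peels off one generator at a time and leaves
    this iterated difference in the span of the empty set.\<close>
  have "X - (\<lambda>x. scale c0 (F0 x)) - (\<lambda>x. scale c1 (F1 x)) - (\<lambda>x. scale c2 (F2 x))
        - (\<lambda>x. scale c3 (F3 x)) = 0 \<longleftrightarrow>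
      X = (\<lambda>x. scale c0 (F0 x) + scale c1 (F1 x) + scale c2 (F2 x) + scale c3 (F3 x))" for c0 c1 c2 c3
    by (simp only: diff_diff_eq right_minus_eq) (simp add: plus_fun_def add.assoc)
  then show ?thesis
    by (simp only: W.span_breakdown_eq W.span_empty singleton_iff)
qed

lemma zero_diagonal_space_nonzero_iff:
  assumes "1 < d"
    and sys: "local.leonard_system d A E Astar Estar"
    and dual: "local.dual_eigenvalue_sequence d Astar Estar theta_star"
    and a: "\<forall>i\<le>d. a i = local.trace (Estar i \<circ> A)"
  shows "local.zero_diagonal_space d A Astar Estar \<noteq> {0} \<longleftrightarrow>
    (\<exists>f0 f1 f2 f3. \<not> (f0 = 0 \<and> f1 = 0 \<and> f2 = 0 \<and> f3 = 0) \<and>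
       (\<forall>i\<le>d. f0 + f1 * theta_star i + f2 * a i + f3 * a i * theta_star i = 0))"
    (is "_ \<longleftrightarrow> (\<exists>f0 f1 f2 f3. ?nz f0 f1 f2 f3 \<and> ?rel f0 f1 f2 f3)")
proof -
  have A: "Vector_Spaces.linear scale scale A"
    using sys by (simp add: local.leonard_system_def local.leonard_pair_def)
  interpret A: Vector_Spaces.linear scale scale A by (rule A)
  obtain t v where t: "inj_on t {..d}"
    and eig: "\<And>i. i \<le> d \<Longrightarrow> v i \<noteq> 0 \<and> Astar (v i) = scale (t i) (v i)"
    and v: "local.ordered_basis d v"
    and tri: "local.irreducible_tridiagonal_wrt d v A"
    and prim: "\<And>i. i \<le> d \<Longrightarrow> local.primitive_idempotent Astar (t i) (Estar i)"
    using sys unfolding local.leonard_system_def local.standard_idempotent_ordering_def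
      local.standard_eigenvalue_ordering_def bij_betw_def by blast
  \<comment> \<open>For indices up to \<open>d\<close>, \<open>r j (A (v i))\<close> is the entry of
    \<open>A\<close> in row \<open>j\<close> and column \<open>i\<close>.\<close>
  define r where "r i x = representation (v ` {..d}) x (v i)" for i x
  have rv: "r i (v j) = (if i = j then 1 else 0)" if "i \<le> d" "j \<le> d" for i j
    unfolding r_def using representation_ordered_basis[OF v that] .
  have r_lin: "Vector_Spaces.linear scale (*) (r i)" for i
    unfolding r_def by (rule linear_representation[OF v])
  have r_add: "r i (x + y) = r i x + r i y" and r_scale: "r i (scale c x) = c * r i x" for i x y c
    using Vector_Spaces.linear.axioms(3)[OF r_lin[of i]]
    by (auto simp: module_hom_def module_hom_axioms_def)
  have Estar: "Estar i x = scale (r i x) (v i)" if "i \<le> d" for i x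
    unfolding r_def using primitive_idempotent_eigenbasis[OF prim[OF that] t v eig that] .
  \<comment> \<open>\<open>t\<close> comes from the eigenvectors, \<open>theta_star\<close> from the
    idempotents; evaluating at \<open>v i\<close>, which \<open>Estar i\<close> fixes, identifies
    them.\<close>
  have theta: "theta_star i = t i" if "i \<le> d" for i
  proof -
    have "Astar (Estar i (v i)) = scale (theta_star i) (Estar i (v i))"
      using dual that by (auto simp: local.dual_eigenvalue_sequence_def fun_eq_iff)
    then show ?thesis using that eig[OF that] by (simp add: Estar rv)
  qed
  have diag: "r i (A (v i)) = a i" if "i \<le> d" for i
    using trace_coordinate_projection_comp[OF v that Estar[OF that, unfolded r_def] A] a that
    by (simp add: local.matrix_entry_def r_def)
  have sub: "r (Suc i) (A (v i)) \<noteq> 0" if "i < d" for i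
    using tri that by (simp add: local.irreducible_tridiagonal_wrt_def local.matrix_entry_def r_def)
  define X where "X f0 f1 f2 f3 =
    (\<lambda>x. scale f0 x + scale f1 (Astar x) + scale f2 (A x) + scale f3 (A (Astar x)))" for f0 f1 f2 f3
  \<comment> \<open>On \<open>v i\<close> the map \<open>Astar\<close> acts as the scalar
    \<open>t i\<close>, so the four coefficients combine into one factor for the identity and one
    for \<open>A\<close>.\<close>
  have X_v: "r j (X f0 f1 f2 f3 (v i)) =
      (f0 + f1 * t i) * r j (v i) + (f2 + f3 * t i) * r j (A (v i))"
    if "i \<le> d" for i j f0 f1 f2 f3
    using eig[OF that] by (simp add: X_def r_add r_scale A.scale algebra_simps)
  have X_scale: "X f0 f1 f2 f3 (scale c (v i)) = scale c (X f0 f1 f2 f3 (v i))" if "i \<le> d" for f0 f1 f2 f3 c i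
  proof -
    have "Vector_Spaces.linear scale scale Astar"
      using sys by (simp add: local.leonard_system_def local.leonard_pair_def)
    then interpret S: Vector_Spaces.linear scale scale Astar .
    show ?thesis
      by (simp add: X_def S.scale A.scale algebra_simps)
  qed
  have sandwich: "(\<forall>i\<le>d. Estar i \<circ> X f0 f1 f2 f3 \<circ> Estar i = 0) \<longleftrightarrow> ?rel f0 f1 f2 f3" for f0 f1 f2 f3
  proof -
    have "Estar i \<circ> X f0 f1 f2 f3 \<circ> Estar i = 0 \<longleftrightarrow>
        f0 + f1 * theta_star i + f2 * a i + f3 * a i * theta_star i = 0" if i: "i \<le> d" for i
    proof -
      let ?e = "f0 + f1 * theta_star i + f2 * a i + f3 * a i * theta_star i"
      \<comment> \<open>\<open>Estar i x\<close> is a multiple of \<open>v i\<close>, so only the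
        \<open>i\<close>-th diagonal entry of \<open>X f0 f1 f2 f3\<close> survives.\<close>
      have "(Estar i \<circ> X f0 f1 f2 f3 \<circ> Estar i) x = scale (r i x * ?e) (v i)" for x
        using i by (simp add: Estar X_scale r_scale X_v rv diag theta algebra_simps)
      then have "Estar i \<circ> X f0 f1 f2 f3 \<circ> Estar i = 0 \<longleftrightarrow> (\<forall>x. r i x * ?e = 0)"
        using eig[OF i] by (simp only: fun_eq_iff zero_fun_def scale_eq_0_iff) simp
      \<comment> \<open>The choice \<open>x = v i\<close> has \<open>r i x = 1\<close>.\<close>
      also have "\<dots> \<longleftrightarrow> ?e = 0"
        using rv[OF i i] by (metis mult_1 mult_zero_right)
      finally show ?thesis .
    qed
    then show ?thesis by blast
  qed
  \<comment> \<open>This is the linear independence of the identity, \<open>Astar\<close>,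
    \<open>A\<close> and \<open>A \<circ> Astar\<close>.\<close>
  have X_nonzero: "X f0 f1 f2 f3 \<noteq> 0" if "?nz f0 f1 f2 f3" for f0 f1 f2 f3
  proof
    assume 0: "X f0 f1 f2 f3 = 0"
    have zero: "(f0 + f1 * t i) * r j (v i) + (f2 + f3 * t i) * r j (A (v i)) = 0" if "i \<le> d" for i j
      using X_v[OF that, of j f0 f1 f2 f3] r_scale[of j 0 0] by (simp add: 0)
    have t01: "t 0 \<noteq> t 1"
      using t \<open>1 < d\<close> by (auto simp: inj_on_eq_iff)
    \<comment> \<open>An affine function with two distinct zeros has zero coefficients.\<close>
    have vanish: "c = 0 \<and> c' = 0" if "c + c' * t 0 = 0" "c + c' * t 1 = 0" for c c'
    proof -
      have "c' * (t 0 - t 1) = 0"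
        using that by (metis add_left_cancel right_diff_distrib right_minus_eq)
      with t01 that show ?thesis by simp
    qed
    have f23: "f2 + f3 * t i = 0" if "i < d" for i
      using zero[of i "Suc i"] sub[OF that] that by (simp add: rv)
    \<comment> \<open>With the factor of \<open>A\<close> gone, the diagonal entry isolates
      \<open>f0\<close> and \<open>f1\<close>.\<close>
    have f01: "f0 + f1 * t i = 0" if "i < d" for i
      using zero[of i i] f23[OF that] that by (simp add: rv)
    \<comment> \<open>Both relations are used at the indices 0 and 1, which lie below
      \<open>d\<close>.\<close>
    show False
      using vanish[OF f23 f23] vanish[OF f01 f01] \<open>1 < d\<close> that by simp
  qed
  have Z: "local.zero_diagonal_space d A Astar Estar = {X f0 f1 f2 f3 |f0 f1 f2 f3. ?rel f0 f1 f2 f3}"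
  proof -
    have *: "Y \<in> local.zero_diagonal_space d A Astar Estar \<longleftrightarrow>
        (\<exists>f0 f1 f2 f3. Y = X f0 f1 f2 f3) \<and> (\<forall>i\<le>d. Estar i \<circ> Y \<circ> Estar i = 0)" for Y
      unfolding local.zero_diagonal_space_def span_pointwise_four X_def by simp
    then show ?thesis
      unfolding set_eq_iff mem_Collect_eq * sandwich[symmetric] by blast
  qed
  have X_zero: "X 0 0 0 0 = 0"
    by (simp add: X_def fun_eq_iff)
  have "0 \<in> local.zero_diagonal_space d A Astar Estar"
    unfolding Z using X_zero by (auto intro!: exI[of _ 0])
  then have "local.zero_diagonal_space d A Astar Estar \<noteq> {0} \<longleftrightarrow>
      (\<exists>Y\<in>local.zero_diagonal_space d A Astar Estar. Y \<noteq> 0)"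
    by blast
  also have "\<dots> \<longleftrightarrow> (\<exists>f0 f1 f2 f3. ?rel f0 f1 f2 f3 \<and> X f0 f1 f2 f3 \<noteq> 0)"
    unfolding Z by blast
  also have "\<dots> \<longleftrightarrow> (\<exists>f0 f1 f2 f3. ?nz f0 f1 f2 f3 \<and> ?rel f0 f1 f2 f3)"
  proof -
    have "X f0 f1 f2 f3 \<noteq> 0 \<longleftrightarrow> ?nz f0 f1 f2 f3" for f0 f1 f2 f3
      using X_nonzero[of f0 f1 f2 f3] X_zero by (cases "?nz f0 f1 f2 f3") auto
    then show ?thesis
      by (simp only: conj_commute)
  qed
  finally show ?thesis .
qed

end

theorem lemma5p2:
  fixes scale :: "'f::alg_closed_field \<Rightarrow> 'v::ab_group_add \<Rightarrow> 'v"
    and d :: nat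
    and A Astar :: "'v \<Rightarrow> 'v"
    and E Estar :: "nat \<Rightarrow> 'v \<Rightarrow> 'v"
    and theta_star a :: "nat \<Rightarrow> 'f"
  assumes "vector_space scale"
    and "vector_space.dim scale (UNIV :: 'v set) = d + 1"
    and "d \<ge> 3"
    and "vector_space.leonard_system scale d A E Astar Estar"
    and "vector_space.dual_eigenvalue_sequence scale d Astar Estar theta_star"
    and "\<forall>i\<le>d. a i = vector_space.trace scale (Estar i \<circ> A)"
  shows "vector_space.zero_diagonal_space scale d A Astar Estar \<noteq> {0} \<longleftrightarrow>
    (\<exists>f0 f1 f2 f3. \<not> (f0 = 0 \<and> f1 = 0 \<and> f2 = 0 \<and> f3 = 0) \<and>
       (\<forall>i\<le>d. f0 + f1 * theta_star i + f2 * a i + f3 * a i * theta_star i = 0))"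
proof -
  have "1 < d"
    using assms(3) by simp
  then show ?thesis
    by (rule vector_space.zero_diagonal_space_nonzero_iff[OF assms(1) _ assms(4-6)])
qed

end
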